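(* Let $p_1,p_2\ge2$, $p=p_1p_2$, and let $h$ be either the symmetric square root map or the Cholesky factor map on $\mathcal{S}_{p_1,p_2}^{++}$. Given $\Sigma\in\mathcal{S}_p^{++}$, let $K=k(\Sigma)=\Sigma_2\otimes\Sigma_1$ and $C=c(\Sigma)$. Let $U=U_2\otimes\Sigma_1+\Sigma_2\otimes U_1\in T_{\Sigma_2\otimes\Sigma_1}\mathcal{S}_{p_1,p_2}^{++}$ with $U_i\in\mathcal{S}_{p_i}$, and let $W\in T_C\mathcal{C}_{p_1,p_2}^{++}$. For the map $g:(K,C)\in\mathcal{S}_{p_1,p_2}^{++}\times\mathcal{C}_{p_1,p_2}^{++}\mapsto h(K)Ch(K)^\top\in\mathcal{S}_p^{++}$, the differential is $$dg(K,C)[U,W]=h(K)Wh(K)^\top+(dh(K)[U])\,C\,h(K)^\top+h(K)\,C\,(dh(K)[U])^\top,$$ where, if $h$ is the Cholesky factor, $dh(K)[U]=(L_2\otimes L_1)\big(I_{p_2}\otimes L_1^{-1}U_1L_1^{-\top}+L_2^{-1}U_2L_2^{-\top}\otimes I_{p_1}\big)_{\frac12}$, and if $h$ is the symmetric square root, $dh(K)[U]=(\Gamma_2\otimes\Gamma_1)\big[\Lambda^{-}\circ(\Lambda_2\otimes\Gamma_1^\top U_1\Gamma_1+\Gamma_2^\top U_2\Gamma_2\otimes\Lambda_1)\big](\Gamma_2\otimes\Gamma_1)^\top$.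
   Context: $\mathcal{S}_q$, $\mathcal{S}_q^{++}$: real symmetric, resp. symmetric positive definite, $q\times q$ matrices. $\mathcal{S}_{p_1,p_2}^{++}=\{\Sigma_2\otimes\Sigma_1:\Sigma_i\in\mathcal{S}_{p_i}^{++}\}$, a smooth manifold with tangent space $\{U_2\otimes\Sigma_1+\Sigma_2\otimes U_1:U_i\in\mathcal{S}_{p_i}\}$ at $\Sigma_2\otimes\Sigma_1$. For $M\in\mathcal{S}_p$ with $p_1\times p_1$ blocks $M_{[i,j]}$ ($1\le i,j\le p_2$), $\mathrm{tr}_1(M)=\sum_iM_{[i,i]}$ and $\mathrm{tr}_2(M)=(\mathrm{tr}(M_{[i,j]}))_{i,j}$. Kronecker map: $k(\Sigma)$ is the unique minimizer of $\mathrm{tr}(\Sigma(K_2\otimes K_1)^{-1})+p_1\log|K_2|+p_2\log|K_1|$ over $\mathcal{S}_{p_1,p_2}^{++}$. $\mathcal{C}_{p_1,p_2}^{++}=\{C\in\mathcal{S}_p^{++}:k(C)=I_p\}=\{C\in\mathcal{S}_p^{++}:\mathrm{tr}_1(C)=p_2I_{p_1},\mathrm{tr}_2(C)=p_1I_{p_2}\}$, an embedded submanifold of $\mathcal{S}_p^{++}$ with tangent space $\{W\in\mathcal{S}_p:\mathrm{tr}_1(W)=0,\mathrm{tr}_2(W)=0\}$ at every point. $h(K)$ is the symmetric positive definite square root of $K$, or its lower triangular Cholesky factor with positive diagonal. Core map: $c(\Sigma)=h(k(\Sigma))^{-1}\Sigma h(k(\Sigma))^{-\top}$. $L_i$ is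 the Cholesky factor of $\Sigma_i$; $\Sigma_i=\Gamma_i\Lambda_i\Gamma_i^\top$ is an eigendecomposition ($\Gamma_i$ orthogonal, $\Lambda_i$ diagonal); $\lambda_i\in\mathbb{R}^{p_i}$ is the vector of diagonal entries of $\Lambda_i^{1/2}$; $\Lambda^{-}$ is the entrywise inverse of $\Lambda=\mathbf{1}_{p_2}\lambda_2^\top\otimes\mathbf{1}_{p_1}\lambda_1^\top+\lambda_2\mathbf{1}_{p_2}^\top\otimes\lambda_1\mathbf{1}_{p_1}^\top$; $\circ$ is the Hadamard product. For symmetric $M$, $(M)_{\frac12}$ is the strictly lower triangular part of $M$ plus half its diagonal part. *)

theory Defs
  imports "HOL-Analysis.Analysis"
begin

text \<open>
  Velocities at \<open>x\<close> of curves in \<open>M\<close> through \<open>x\<close>. For an embedded submanifold \<open>M\<close> this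
  is the usual tangent space.
\<close>

definition tangent_space :: "'a::real_normed_vector set \<Rightarrow> 'a \<Rightarrow> 'a set" where
  "tangent_space M x =
     {v. \<exists>\<gamma> e. e > 0 \<and> (\<forall>t::real. \<bar>t\<bar> < e \<longrightarrow> \<gamma> t \<in> M) \<and> \<gamma> 0 = x \<and>
           (\<gamma> has_vector_derivative v) (at 0)}"

text \<open>
  If \<open>M\<close> is not full-dimensional, the Frechet derivative of \<open>f\<close> within \<open>M\<close> is not unique as a
  linear map on the ambient space, but its values on tangent vectors are; see
  \<open>differential_eqI\<close> below.
\<close>

definition differential ::
    "('a::real_normed_vector \<Rightarrow> 'b::real_normed_vector) \<Rightarrow> 'a set \<Rightarrow> 'a \<Rightarrow> 'a \<Rightarrow> 'b" where
  "differential f M x = frechet_derivative f (at x within M)"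

lemma tangent_curve_derivative:
  assumes "(f has_derivative f') (at x within M)"
    and "e > 0" "\<And>t::real. \<bar>t\<bar> < e \<Longrightarrow> \<gamma> t \<in> M" "\<gamma> 0 = x"
    and "(\<gamma> has_vector_derivative v) (at 0)"
  shows "((f \<circ> \<gamma>) has_vector_derivative f' v) (at 0)"
proof -
  let ?S = "{-e<..<e}"
  have at: "at 0 within ?S = at (0::real)"
    using \<open>e > 0\<close> by (intro at_within_open) auto
  have "\<gamma> ` ?S \<subseteq> M"
    using assms(3) by (auto simp: abs_less_iff)
  then have "(f has_derivative f') (at (\<gamma> 0) within \<gamma> ` ?S)"
    using assms(1,4) has_derivative_subset by blast
  moreover have "(\<gamma> has_derivative (\<lambda>t. t *\<^sub>R v)) (at 0 within ?S)"
    using assms(5) by (simp add: at has_vector_derivative_def)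
  ultimately have "((f \<circ> \<gamma>) has_derivative (f' \<circ> (\<lambda>t. t *\<^sub>R v))) (at 0 within ?S)"
    by (rule diff_chain_within[rotated])
  moreover have "f' \<circ> (\<lambda>t. t *\<^sub>R v) = (\<lambda>t. t *\<^sub>R f' v)"
    using has_derivative_linear[OF assms(1)] by (auto simp: linear_scale)
  ultimately show ?thesis
    by (simp add: at has_vector_derivative_def)
qed

lemma differential_eqI:
  assumes f: "(f has_derivative f') (at x within M)" and v: "v \<in> tangent_space M x"
  shows "differential f M x v = f' v"
proof -
  have d: "(f has_derivative differential f M x) (at x within M)"
    using f frechet_derivative_works
    unfolding differential_def differentiable_def by blast
  obtain \<gamma> e where c: "e > 0" "\<And>t::real. \<bar>t\<bar> < e \<Longrightarrow> \<gamma> t \<in> M" "\<gamma> 0 = x"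
      "(\<gamma> has_vector_derivative v) (at 0)"
    using v unfolding tangent_space_def by auto
  show ?thesis
    using tangent_curve_derivative[OF d c] tangent_curve_derivative[OF f c]
    by (rule vector_derivative_unique_at)
qed

type_synonym 'n sqmat = "((real, 'n) vec, 'n) vec"

definition sym_mats :: "(real^'n^'n) set" where
  "sym_mats = {A. transpose A = A}"

definition spd_mats :: "(real^'n::finite^'n) set" where
  "spd_mats = {A \<in> sym_mats. \<forall>x. x \<noteq> 0 \<longrightarrow> x \<bullet> (A *v x) > 0}"

definition spd_sqrt :: "real^'n::finite^'n \<Rightarrow> real^'n^'n" where
  "spd_sqrt A = (THE S. S \<in> spd_mats \<and> S ** S = A)"

text \<open>
  Triangularity refers to a strict linear order \<open>r\<close> on the index type. The order is a
  parameter because the product index type carries the lexicographic order \<open>lex_less\<close> below,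
  which is not a type class instance.
\<close>

definition cholesky :: "('n \<Rightarrow> 'n \<Rightarrow> bool) \<Rightarrow> real^'n::finite^'n \<Rightarrow> real^'n^'n" where
  "cholesky r A =
     (THE L. (\<forall>i j. r i j \<longrightarrow> L $ i $ j = 0) \<and> (\<forall>i. L $ i $ i > 0) \<and> L ** transpose L = A)"

definition lower_half :: "('n \<Rightarrow> 'n \<Rightarrow> bool) \<Rightarrow> real^'n::finite^'n \<Rightarrow> real^'n^'n" where
  "lower_half r M =
     (\<chi> i j. if r j i then M $ i $ j else if i = j then M $ i $ j / 2 else 0)"

text \<open>
  A \<open>p\<^sub>1 p\<^sub>2 \<times> p\<^sub>1 p\<^sub>2\<close> matrix is indexed by pairs \<open>(i, a)\<close>, where \<open>i\<close> (ranging over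
  \<open>p\<^sub>2\<close> values) is the number of the block and \<open>a\<close> (ranging over \<open>p\<^sub>1\<close> values) the
  position inside the block. The usual enumeration of rows is then the lexicographic order.
\<close>

definition lex_less :: "'b::linorder \<times> 'a::linorder \<Rightarrow> 'b \<times> 'a \<Rightarrow> bool" where
  "lex_less x y \<longleftrightarrow> fst x < fst y \<or> (fst x = fst y \<and> snd x < snd y)"

definition kron :: "real^'b^'b \<Rightarrow> real^'a^'a \<Rightarrow> real^('b \<times> 'a)^('b \<times> 'a)"
    (infixl "\<otimes>\<^sub>K" 75) where
  "B \<otimes>\<^sub>K A = (\<chi> x y. B $ fst x $ fst y * A $ snd x $ snd y)"

definition kron_spd :: "(real^('b::finite \<times> 'a::finite)^('b \<times> 'a)) set" where
  "kron_spd = {B \<otimes>\<^sub>K A | B A. B \<in> spd_mats \<and> A \<in> spd_mats}"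

definition kron_objective ::
    "real^('b::finite \<times> 'a::finite)^('b \<times> 'a) \<Rightarrow> real^'b^'b \<Rightarrow> real^'a^'a \<Rightarrow> real" where
  "kron_objective S K2 K1 =
     trace (S ** matrix_inv (K2 \<otimes>\<^sub>K K1)) + real CARD('a) * ln (det K2) + real CARD('b) * ln (det K1)"

text \<open>
  The objective depends on \<open>K\<^sub>2\<close> and \<open>K\<^sub>1\<close> only through their Kronecker product, which is
  what is unique about the minimizer.
\<close>

definition kron_map ::
    "real^('b::finite \<times> 'a::finite)^('b \<times> 'a) \<Rightarrow> real^('b \<times> 'a)^('b \<times> 'a)" where
  "kron_map S =
     (THE K. \<exists>K2\<in>spd_mats. \<exists>K1\<in>spd_mats. K = K2 \<otimes>\<^sub>K K1 \<and>
        (\<forall>J2\<in>spd_mats. \<forall>J1\<in>spd_mats. kron_objective S K2 K1 \<le> kron_objective S J2 J1))"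

definition core_spd :: "(real^('b::finite \<times> 'a::finite)^('b \<times> 'a)) set" where
  "core_spd = {C \<in> spd_mats. kron_map C = mat 1}"

definition core_map ::
    "(real^('b \<times> 'a)^('b \<times> 'a) \<Rightarrow> real^('b \<times> 'a)^('b \<times> 'a)) \<Rightarrow>
     real^('b::finite \<times> 'a::finite)^('b \<times> 'a) \<Rightarrow> real^('b \<times> 'a)^('b \<times> 'a)" where
  "core_map h S =
     matrix_inv (h (kron_map S)) ** S ** transpose (matrix_inv (h (kron_map S)))"

definition assemble ::
    "(real^'n^'n \<Rightarrow> real^'n^'n) \<Rightarrow> (real^'n^'n) \<times> (real^'n^'n) \<Rightarrow> real^'n::finite^'n" where
  "assemble h = (\<lambda>(K, C). h K ** C ** transpose (h K))"

definition eigendecomposition ::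
    "real^'n::finite^'n \<Rightarrow> real^'n^'n \<Rightarrow> real^'n^'n \<Rightarrow> bool" where
  "eigendecomposition S G D \<longleftrightarrow>
     orthogonal_matrix G \<and> (\<forall>i j. i \<noteq> j \<longrightarrow> D $ i $ j = 0) \<and> S = G ** D ** transpose G"

definition sqrt_diag :: "real^'n^'n \<Rightarrow> real^'n" where
  "sqrt_diag D = (\<chi> i. sqrt (D $ i $ i))"

definition outer :: "real^'n \<Rightarrow> real^'n \<Rightarrow> real^'n^'n" where
  "outer u v = (\<chi> i j. u $ i * v $ j)"

definition hadamard :: "real^'n^'n \<Rightarrow> real^'n^'n \<Rightarrow> real^'n^'n" where
  "hadamard A B = (\<chi> i j. A $ i $ j * B $ i $ j)"

definition entrywise_inverse :: "real^'n^'n \<Rightarrow> real^'n^'n" where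
  "entrywise_inverse A = (\<chi> i j. inverse (A $ i $ j))"

definition sqrt_sum_matrix ::
    "real^'b^'b \<Rightarrow> real^'a^'a \<Rightarrow> real^('b \<times> 'a)^('b \<times> 'a)" where
  "sqrt_sum_matrix D2 D1 =
     outer 1 (sqrt_diag D2) \<otimes>\<^sub>K outer 1 (sqrt_diag D1)
     + outer (sqrt_diag D2) 1 \<otimes>\<^sub>K outer (sqrt_diag D1) 1"

end

theory Submission
  imports Defs
begin

text \<open>
  Both maps \<open>h\<close> invert a quadratic map: \<open>S \<mapsto> S\<^sup>2\<close> on symmetric, or \<open>L \<mapsto> L L\<^sup>T\<close> on lower triangular
  matrices. Extended suitably to all square matrices, the quadratic map is injective on an open
  set by uniqueness of the factorisation, so the inverse function theorem differentiates \<open>h\<close>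
  along the symmetric matrices. The derivative is found by solving the linearised equation:
  \<open>S X + X S = E\<close> is diagonal in an eigenbasis of \<open>S\<close>, and \<open>X L\<^sup>T + L X\<^sup>T = E\<close> holds for \<open>X = L Y\<close>
  with \<open>Y\<close> the halved lower part of \<open>L\<^sup>-\<^sup>1 E L\<^sup>-\<^sup>T\<close>. Eigendecompositions and Cholesky factors are
  compatible with Kronecker products, which gives the stated formulas, and the differential of
  \<open>g\<close> follows from the product rule.
\<close>

section \<open>Matrix algebra\<close>

lemma bounded_bilinear_matrix_mult:
  "bounded_bilinear ((**) :: real^'b::finite^'a::finite \<Rightarrow> real^'c::finite^'b \<Rightarrow> real^'c^'a)"
  unfolding bilinear_conv_bounded_bilinear[symmetric] bilinear_def
  by (auto intro!: linearI
      simp: vec_eq_iff matrix_matrix_mult_def sum.distrib sum_distrib_left algebra_simps)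

lemmas has_derivative_matrix_mult [derivative_intros] =
  bounded_bilinear.FDERIV[OF bounded_bilinear_matrix_mult]

lemma bounded_linear_transpose:
  "bounded_linear (transpose :: real^'b::finite^'a::finite \<Rightarrow> real^'a^'b)"
  unfolding linear_conv_bounded_linear[symmetric]
  by (auto intro!: linearI simp: vec_eq_iff transpose_def)

lemmas has_derivative_transpose [derivative_intros] =
  bounded_linear.has_derivative[OF bounded_linear_transpose]

lemma transpose_add: "transpose (A + B) = transpose A + transpose B"
  by (simp add: vec_eq_iff transpose_def)

lemma transpose_diff: "transpose (A - B :: real^'b^'a) = transpose A - transpose B"
  by (simp add: vec_eq_iff transpose_def)

lemma transpose_eqD: "transpose A = A \<Longrightarrow> A $ i $ j = A $ j $ i"
  by (drule arg_cong[where f = "\<lambda>M. M $ j $ i"]) (simp add: transpose_def)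

lemma matrix_add_rdistrib: "(A + B) ** C = A ** C + (B :: real^'b^'a) ** (C :: real^'c^'b)"
  by (simp add: vec_eq_iff matrix_matrix_mult_def sum.distrib algebra_simps)

lemma matrix_diff_ldistrib: "A ** (B - C) = A ** B - A ** (C :: real^'c^'b)"
  by (simp add: vec_eq_iff matrix_matrix_mult_def sum_subtractf algebra_simps)

lemma matrix_diff_rdistrib: "(A - B) ** C = A ** C - (B :: real^'b^'a) ** (C :: real^'c^'b)"
  by (simp add: vec_eq_iff matrix_matrix_mult_def sum_subtractf algebra_simps)

lemma inner_matrix_vector: "x \<bullet> (A *v y) = (transpose A *v x) \<bullet> (y :: real^'n)"
  by (simp add: dot_lmul_matrix)

lemma invertible_inv:
  fixes A :: "real^'n^'n"
  assumes "invertible A"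
  shows "A ** matrix_inv A = mat 1" "matrix_inv A ** A = mat 1"
proof -
  have "A ** matrix_inv A = mat 1 \<and> matrix_inv A ** A = mat 1"
    using assms unfolding invertible_def matrix_inv_def by (rule someI_ex)
  then show "A ** matrix_inv A = mat 1" "matrix_inv A ** A = mat 1"
    by auto
qed

lemma matrix_inv_eqI:
  fixes A :: "real^'n^'n"
  assumes "A ** B = mat 1"
  shows "matrix_inv A = B"
proof -
  have "invertible A"
    using assms invertible_right_inverse by blast
  then have "matrix_inv A ** A ** B = B"
    by (simp add: invertible_inv)
  then show ?thesis
    using assms by (simp add: matrix_mul_assoc[symmetric])
qed

text \<open>Projection onto the symmetric matrices. The inverse function theorem needs an open
  domain, so maps that make sense only for symmetric arguments are precomposed with it to live on
  all square matrices.\<close>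

definition sym_part :: "real^'n^'n \<Rightarrow> real^'n^'n" where
  "sym_part A = (1/2) *\<^sub>R (A + transpose A)"

lemma linear_sym_part: "linear (sym_part :: real^'n^'n \<Rightarrow> real^'n^'n)"
  by (auto intro!: linearI simp: vec_eq_iff sym_part_def transpose_def algebra_simps)

lemma has_derivative_sym_part [derivative_intros]:
  "(f has_derivative f') F \<Longrightarrow> ((\<lambda>x. sym_part (f x)) has_derivative (\<lambda>x. sym_part (f' x))) F"
  using bounded_linear.has_derivative[OF linear_sym_part[unfolded linear_conv_bounded_linear]] .

lemma sym_part_sym: "A \<in> sym_mats \<Longrightarrow> sym_part A = A"
  by (simp add: sym_part_def sym_mats_def vec_eq_iff)

lemma sym_part_in_sym: "sym_part A \<in> sym_mats"
  by (simp add: sym_part_def sym_mats_def vec_eq_iff transpose_def add.commute)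

lemma sym_part_diff: "sym_part (A - B) = sym_part A - sym_part B"
  using linear_diff[OF linear_sym_part] .

lemma sym_part_add: "sym_part (A + B) = sym_part A + sym_part B"
  using linear_add[OF linear_sym_part] .

text \<open>The antisymmetric part contributes nothing to a quadratic form, so positivity of the
  form of \<open>M\<close> puts \<open>sym_part M\<close> into \<open>spd_mats\<close>.\<close>

lemma inner_sym_part: "x \<bullet> (sym_part A *v x) = x \<bullet> (A *v x)"
proof -
  have "x \<bullet> (transpose A *v x) = x \<bullet> (A *v x)"
    using inner_matrix_vector[of x A x] by (simp add: inner_commute)
  moreover have "2 *\<^sub>R (sym_part A *v x) = A *v x + transpose A *v x"
    unfolding sym_part_def
    by (simp add: scaleR_matrix_vector_assoc matrix_vector_mult_add_rdistrib
        del: transpose_matrix_vector)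
  then have "2 * (x \<bullet> (sym_part A *v x)) = x \<bullet> (A *v x) + x \<bullet> (transpose A *v x)"
    by (metis inner_add_right inner_scaleR_right)
  ultimately show ?thesis
    by simp
qed

section \<open>The symmetric positive definite square root\<close>

lemma spd_matsD:
  assumes "A \<in> spd_mats"
  shows "transpose A = A" "x \<noteq> 0 \<Longrightarrow> x \<bullet> (A *v x) > 0" "x \<bullet> (A *v x) \<ge> 0"
proof -
  show "transpose A = A" and pos: "x \<noteq> 0 \<Longrightarrow> x \<bullet> (A *v x) > 0"
    using assms by (auto simp: spd_mats_def sym_mats_def)
  show "x \<bullet> (A *v x) \<ge> 0"
    by (cases "x = 0") (simp_all add: pos less_imp_le)
qed

text \<open>By homogeneity it suffices to test unit vectors. The complement is then the projection,
  along the compact unit sphere, of the closed set where the form is nonpositive, hence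
  closed.\<close>

lemma open_positive_definite:
  "open {A :: real^'n::finite^'n. \<forall>x. x \<noteq> 0 \<longrightarrow> x \<bullet> (A *v x) > 0}"
proof -
  let ?q = "\<lambda>p :: (real^'n) \<times> (real^'n^'n). fst p \<bullet> (snd p *v fst p)"
  have "continuous_on UNIV ?q"
    unfolding inner_vec_def matrix_vector_mult_def by (auto intro!: continuous_intros)
  then have "closed {p. ?q p \<le> 0}"
    by (intro closed_Collect_le) (auto intro!: continuous_intros)
  then have cl: "closed {A. \<exists>x. x \<in> sphere 0 1 \<and> (x, A) \<in> {p. ?q p \<le> 0}}"
    by (intro closed_compact_projection) auto
  have pos: "x \<bullet> (A *v x) > 0"
    if u: "\<And>u. norm u = 1 \<Longrightarrow> u \<bullet> (A *v u) > 0" and "x \<noteq> 0" for A :: "real^'n^'n" and x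
  proof -
    have "x = norm x *\<^sub>R sgn x"
      using \<open>x \<noteq> 0\<close> by (simp add: sgn_div_norm)
    then have "x \<bullet> (A *v x) = (norm x *\<^sub>R sgn x) \<bullet> (A *v (norm x *\<^sub>R sgn x))"
      by simp
    also have "\<dots> = (norm x)\<^sup>2 * (sgn x \<bullet> (A *v sgn x))"
      by (simp only: inner_scaleR_left inner_scaleR_right matrix_vector_mult_scaleR mult.assoc
          power2_eq_square)
    finally show ?thesis
      using u[of "sgn x"] \<open>x \<noteq> 0\<close> by (simp add: norm_sgn)
  qed
  have eq: "{A :: real^'n^'n. \<forall>x. x \<noteq> 0 \<longrightarrow> x \<bullet> (A *v x) > 0} =
      - {A. \<exists>x. x \<in> sphere 0 1 \<and> (x, A) \<in> {p. ?q p \<le> 0}}"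
  proof (intro set_eqI iffI)
    fix A :: "real^'n^'n"
    assume A: "A \<in> {A. \<forall>x. x \<noteq> 0 \<longrightarrow> x \<bullet> (A *v x) > 0}"
    have "x \<noteq> 0" if "x \<in> sphere 0 1" for x :: "real^'n"
      using that by auto
    then show "A \<in> - {A. \<exists>x. x \<in> sphere 0 1 \<and> (x, A) \<in> {p. ?q p \<le> 0}}"
      using A by (auto simp: not_le[symmetric])
  next
    fix A :: "real^'n^'n"
    assume "A \<in> - {A. \<exists>x. x \<in> sphere 0 1 \<and> (x, A) \<in> {p. ?q p \<le> 0}}"
    then have u: "u \<bullet> (A *v u) > 0" if "norm u = 1" for u
      using that by (auto simp: not_le)
    show "A \<in> {A. \<forall>x. x \<noteq> 0 \<longrightarrow> x \<bullet> (A *v x) > 0}"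
      using pos[OF u] by simp
  qed
  show ?thesis
    unfolding eq by (rule open_Compl[OF cl])
qed

text \<open>Pair the equation with \<open>D\<close>: the two terms are sums of the positive definite forms
  over the columns and the rows of \<open>D\<close>.\<close>

lemma sylvester_injective:
  fixes S T D :: "real^'n::finite^'n"
  assumes S: "S \<in> spd_mats" and T: "T \<in> spd_mats" and eq: "S ** D + D ** T = 0"
  shows "D = 0"
proof -
  have a: "(\<Sum>j\<in>UNIV. column j D \<bullet> (S *v column j D)) = (\<Sum>i\<in>UNIV. \<Sum>j\<in>UNIV. D$i$j * (S ** D)$i$j)"
    by (subst sum.swap)
      (simp add: inner_vec_def matrix_vector_mult_def matrix_matrix_mult_def column_def)
  have sT: "T $ i $ k = T $ k $ i" for i k
    using spd_matsD(1)[OF T] by (rule transpose_eqD)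
  have b: "(\<Sum>i\<in>UNIV. row i D \<bullet> (T *v row i D)) = (\<Sum>i\<in>UNIV. \<Sum>j\<in>UNIV. D$i$j * (D ** T)$i$j)"
    by (simp add: inner_vec_def matrix_vector_mult_def matrix_matrix_mult_def row_def)
      (simp add: sT mult.commute)
  have "(\<Sum>j\<in>UNIV. column j D \<bullet> (S *v column j D)) + (\<Sum>i\<in>UNIV. row i D \<bullet> (T *v row i D))
      = (\<Sum>i\<in>UNIV. \<Sum>j\<in>UNIV. D$i$j * (S ** D + D ** T)$i$j)"
    unfolding a b by (simp add: sum.distrib distrib_left)
  also have "\<dots> = 0"
    by (simp add: eq)
  finally have "(\<Sum>j\<in>UNIV. column j D \<bullet> (S *v column j D)) = 0"
    using sum_nonneg[of UNIV "\<lambda>j. column j D \<bullet> (S *v column j D)"]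
      sum_nonneg[of UNIV "\<lambda>i. row i D \<bullet> (T *v row i D)"] spd_matsD(3)[OF S] spd_matsD(3)[OF T]
    by (smt (verit))
  then have "column j D \<bullet> (S *v column j D) = 0" for j
    using spd_matsD(3)[OF S] by (simp add: sum_nonneg_eq_0_iff)
  then have "column j D = 0" for j
    using spd_matsD(2)[OF S] by (metis less_irrefl)
  then show ?thesis
    by (simp add: column_def vec_eq_iff)
qed

text \<open>For two roots \<open>S\<close> and \<open>T\<close>, the difference of their squares is
  \<open>T ** (T - S) + (T - S) ** S\<close>. It vanishes, so the Sylvester equation forces
  \<open>T = S\<close>.\<close>

lemma spd_sqrt_eqI:
  fixes S :: "real^'n::finite^'n"
  assumes S: "S \<in> spd_mats" and "S ** S = A"
  shows "spd_sqrt A = S"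
  unfolding spd_sqrt_def
proof (rule the_equality)
  fix T
  assume T: "T \<in> spd_mats \<and> T ** T = A"
  have "T ** (T - S) + (T - S) ** S = 0"
    using T assms(2) by (simp add: matrix_diff_ldistrib matrix_diff_rdistrib)
  then show "T = S"
    using sylvester_injective[of T S "T - S"] T S by simp
qed (use assms in simp)

section \<open>Diagonal matrices and orthogonal conjugation\<close>

definition diag_mat :: "real^'n \<Rightarrow> real^'n^'n" where
  "diag_mat s = (\<chi> i j. if i = j then s $ i else 0)"

lemma diag_mult: "(diag_mat s ** A) $ i $ j = s $ i * A $ i $ j"
  by (simp add: diag_mat_def matrix_matrix_mult_def if_distrib[of "\<lambda>x. x * _"] cong: if_cong)

lemma mult_diag: "(A ** diag_mat s) $ i $ j = A $ i $ j * s $ j"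
  by (simp add: diag_mat_def matrix_matrix_mult_def if_distrib cong: if_cong)

lemma orthogonal_conj_mult:
  fixes G :: "real^'n::finite^'n"
  assumes "orthogonal_matrix G"
  shows "(G ** A ** transpose G) ** (G ** B ** transpose G) = G ** (A ** B) ** transpose G"
proof -
  have "(G ** A ** transpose G) ** (G ** B ** transpose G)
      = G ** A ** (transpose G ** G) ** (B ** transpose G)"
    by (simp add: matrix_mul_assoc)
  also have "\<dots> = G ** (A ** B) ** transpose G"
    using assms by (subst (asm) orthogonal_matrix) (simp add: matrix_mul_assoc[symmetric])
  finally show ?thesis .
qed

text \<open>In the coordinates \<open>y = transpose G *v x\<close> the form is the weighted sum of
  squares of the \<open>y $ i\<close> with weights \<open>s $ i\<close>, and \<open>y\<close> is
  nonzero when \<open>x\<close> is.\<close>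

lemma spd_diag_conj:
  fixes G :: "real^'n::finite^'n"
  assumes G: "orthogonal_matrix G" and s: "\<And>i. s $ i > 0"
  shows "G ** diag_mat s ** transpose G \<in> spd_mats"
proof -
  have "transpose (diag_mat s) = diag_mat s"
    by (auto simp: diag_mat_def transpose_def vec_eq_iff)
  then have "transpose (G ** diag_mat s ** transpose G) = G ** diag_mat s ** transpose G"
    by (simp add: matrix_transpose_mul matrix_mul_assoc)
  moreover have "x \<bullet> ((G ** diag_mat s ** transpose G) *v x) > 0" if "x \<noteq> 0" for x
  proof -
    let ?y = "transpose G *v x"
    have "G *v ?y = x"
      using G by (simp add: orthogonal_matrix_def matrix_vector_mul_assoc del: transpose_matrix_vector)
    then have "?y \<noteq> 0"
      using that by (metis matrix_vector_mult_0_right)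
    then obtain i where i: "?y $ i \<noteq> 0"
      by (metis vec_eq_iff zero_index)
    have "diag_mat s *v ?y = (\<chi> i. s $ i * ?y $ i)"
      by (simp add: vec_eq_iff matrix_vector_mult_def diag_mat_def
          if_distrib[of "\<lambda>x. x * _"] cong: if_cong)
    then have "?y \<bullet> (diag_mat s *v ?y) = (\<Sum>i\<in>UNIV. s $ i * (?y $ i)\<^sup>2)"
      by (simp add: inner_vec_def power2_eq_square ac_simps)
    also have "\<dots> > 0"
      using i s by (intro sum_pos2[of _ i]) (auto simp: less_imp_le)
    finally show ?thesis
      using inner_matrix_vector[of x G "diag_mat s *v ?y"]
      by (simp add: matrix_vector_mul_assoc matrix_mul_assoc del: transpose_matrix_vector)
  qed
  ultimately show ?thesis
    by (simp add: spd_mats_def sym_mats_def)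
qed

text \<open>The eigenvalue is the value of the quadratic form of \<open>A\<close> at the unit
  eigenvector \<open>G *v axis i 1\<close>.\<close>

lemma eigenvalue_pos:
  fixes A G D :: "real^'n::finite^'n"
  assumes A: "A \<in> spd_mats" and e: "eigendecomposition A G D"
  shows "D $ i $ i > 0"
proof -
  have G: "transpose G ** G = mat 1"
    using e by (simp add: eigendecomposition_def orthogonal_matrix)
  let ?x = "G *v axis i 1"
  have y: "transpose G *v ?x = axis i 1"
    using G by (simp add: matrix_vector_mul_assoc del: transpose_matrix_vector)
  then have "?x \<noteq> 0"
    by (metis axis_eq_0_iff matrix_vector_mult_0_right zero_neq_one)
  then have "0 < ?x \<bullet> (A *v ?x)"
    by (rule spd_matsD(2)[OF A])
  also have "A *v ?x = G *v (D *v (transpose G *v ?x))"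
    using e by (simp add: eigendecomposition_def matrix_vector_mul_assoc matrix_mul_assoc
        del: transpose_matrix_vector)
  also have "?x \<bullet> \<dots> = axis i 1 \<bullet> (D *v axis i 1)"
    by (subst inner_matrix_vector) (simp only: y)
  also have "\<dots> = D $ i $ i"
    by (simp add: inner_axis' matrix_vector_mul_component inner_axis)
  finally show ?thesis .
qed

text \<open>The map \<open>M \<mapsto> (sym M)\<^sup>2 + (M - sym M)\<close> extends squaring from symmetric matrices to all
  matrices and is injective on the open set of matrices with positive definite symmetric part; a
  left inverse needs only uniqueness, not existence, of square roots.\<close>

lemma spd_sqrt_has_derivative:
  fixes A G D :: "real^'n::finite^'n"
  assumes e: "eigendecomposition A G D" and pos: "\<And>i. D $ i $ i > 0"
  shows "(spd_sqrt has_derivative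
      (\<lambda>E. G ** hadamard (entrywise_inverse (\<chi> i j. sqrt (D $ i $ i) + sqrt (D $ j $ j)))
        (transpose G ** sym_part E ** G) ** transpose G)) (at A within sym_mats)"
proof -
  define s where "s = sqrt_diag D"
  define S where "S = G ** diag_mat s ** transpose G"
  define H where "H = (\<lambda>E. hadamard (entrywise_inverse (\<chi> i j. s $ i + s $ j))
        (transpose G ** E ** G))"
  define X where "X = (\<lambda>E. G ** H E ** transpose G)"
  have G: "orthogonal_matrix G"
    using e by (simp add: eigendecomposition_def)
  have s: "s $ i > 0" for i
    using pos by (simp add: s_def sqrt_diag_def)
  have S: "S \<in> spd_mats"
    unfolding S_def by (rule spd_diag_conj[OF G s])
  have "diag_mat s ** diag_mat s = D"
    using e pos by (auto simp: vec_eq_iff diag_mult)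
      (auto simp: diag_mat_def eigendecomposition_def s_def sqrt_diag_def less_imp_le)
  then have SS: "S ** S = A"
    using e by (simp add: S_def orthogonal_conj_mult[OF G] eigendecomposition_def)
  define F where "F = (\<lambda>M :: real^'n^'n. sym_part M ** sym_part M + (M - sym_part M))"
  \<comment> \<open>For \<open>M\<close> with positive definite symmetric part, \<open>F M\<close>
    has symmetric part \<open>sym_part M ** sym_part M\<close> and the same antisymmetric part as
    \<open>M\<close>. \<open>R\<close> recovers the two parts separately.\<close>
  define R where "R = (\<lambda>Y :: real^'n^'n. spd_sqrt (sym_part Y) + (Y - sym_part Y))"
  define F' where "F' = (\<lambda>M. S ** sym_part M + sym_part M ** S + (M - sym_part M))"
  define R' where "R' = (\<lambda>E. X (sym_part E) + (E - sym_part E))"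
  have symS: "sym_part S = S"
    using S by (simp add: sym_part_sym spd_mats_def)
  have dF: "(F has_derivative (\<lambda>E. sym_part M ** sym_part E + sym_part E ** sym_part M
      + (E - sym_part E))) (at M)" for M
    unfolding F_def by (auto intro!: derivative_eq_intros)
  have sym_sq: "B ** B \<in> sym_mats" if "B \<in> sym_mats" for B :: "real^'n^'n"
    using that by (simp add: sym_mats_def matrix_transpose_mul)
  have sym_idem: "sym_part (sym_part B) = sym_part B" for B :: "real^'n^'n"
    by (simp add: sym_part_sym sym_part_in_sym)
  have "(R has_derivative R') (at (F S))"
  \<comment> \<open>This form of the theorem asks for a left inverse of \<open>F\<close> on an open
    set, continuity of \<open>F\<close> there and a right inverse of the derivative at one
    point.\<close>
  proof (rule has_derivative_inverse_strong[where f = F and x = S])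
    show "open {M :: real^'n^'n. \<forall>x. x \<noteq> 0 \<longrightarrow> x \<bullet> (M *v x) > 0}"
      by (rule open_positive_definite)
    show "S \<in> {M. \<forall>x. x \<noteq> 0 \<longrightarrow> x \<bullet> (M *v x) > 0}"
      using S by (simp add: spd_mats_def)
    show "continuous_on {M :: real^'n^'n. \<forall>x. x \<noteq> 0 \<longrightarrow> x \<bullet> (M *v x) > 0} F"
      by (intro continuous_at_imp_continuous_on ballI has_derivative_continuous[OF dF])
    show "(F has_derivative F') (at S)"
      using dF[of S] by (simp add: F'_def symS)
    show "R (F M) = M" if "M \<in> {M. \<forall>x. x \<noteq> 0 \<longrightarrow> x \<bullet> (M *v x) > 0}" for M
    proof -
      have "sym_part M \<in> spd_mats"
        using that by (simp add: spd_mats_def sym_part_in_sym inner_sym_part)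
      moreover have "sym_part (F M) = sym_part M ** sym_part M"
        by (simp add: F_def sym_part_add sym_part_diff sym_idem sym_part_sym sym_sq sym_part_in_sym)
      ultimately show ?thesis
        by (simp add: R_def spd_sqrt_eqI) (simp add: F_def)
    qed
    show "F' \<circ> R' = id"
    proof
      fix E :: "real^'n^'n"
      define V where "V = sym_part E"
      have tV: "transpose V = V"
        using sym_part_in_sym[of E] by (simp add: V_def sym_mats_def)
      have "transpose (H V) = H V"
      proof -
        have "transpose (transpose G ** V ** G) = transpose G ** V ** G"
          by (simp add: matrix_transpose_mul matrix_mul_assoc tV)
        then have "(transpose G ** V ** G) $ i $ j = (transpose G ** V ** G) $ j $ i" for i j
          by (rule transpose_eqD)
        then show ?thesis
          by (simp add: H_def hadamard_def entrywise_inverse_def transpose_def vec_eq_iff add.commute)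
      qed
      then have "X V \<in> sym_mats"
        by (simp add: X_def sym_mats_def matrix_transpose_mul matrix_mul_assoc)
      then have "sym_part (R' E) = X V"
        by (simp add: R'_def sym_part_add sym_part_diff sym_idem sym_part_sym V_def)
      moreover have "S ** X V + X V ** S = V"
      proof -
        have "S ** X V + X V ** S = G ** (diag_mat s ** H V + H V ** diag_mat s) ** transpose G"
          by (simp add: S_def X_def orthogonal_conj_mult[OF G] matrix_add_ldistrib
              matrix_add_rdistrib)
        \<comment> \<open>In the eigenbasis the Sylvester operator multiplies entry (i, j) by
          \<open>s $ i + s $ j\<close>, and the Hadamard factor in \<open>H\<close> divides by
          it.\<close>
        also have "diag_mat s ** H V + H V ** diag_mat s = transpose G ** V ** G"
        proof -
          have "s $ i + s $ j \<noteq> 0" for i j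
            using s[of i] s[of j] by linarith
          then have "s $ i * (inverse (s $ i + s $ j) * B) + inverse (s $ i + s $ j) * B * s $ j = B"
            for i j and B :: real
            by (metis (no_types) distrib_right mult.assoc mult.commute mult_1 right_inverse)
          then show ?thesis
            by (simp add: vec_eq_iff diag_mult mult_diag H_def hadamard_def entrywise_inverse_def)
        qed
        also have "G ** (transpose G ** V ** G) ** transpose G
            = (G ** transpose G) ** V ** (G ** transpose G)"
          by (simp add: matrix_mul_assoc)
        also have "\<dots> = V"
          using G by (simp add: orthogonal_matrix_def)
        finally show ?thesis .
      qed
      ultimately show "(F' \<circ> R') E = id E"
        by (simp add: F'_def) (simp add: R'_def V_def)
    qed
  qed
  moreover have "F S = A"
    by (simp add: F_def symS SS)
  ultimately have "(R has_derivative R') (at A)"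
    by simp
  \<comment> \<open>Removing the linear antisymmetric summand leaves \<open>spd_sqrt\<close> after
    \<open>sym_part\<close>, which agrees with \<open>spd_sqrt\<close> on symmetric
    matrices.\<close>
  then have "((\<lambda>Y. R Y - (Y - sym_part Y)) has_derivative (\<lambda>E. R' E - (E - sym_part E))) (at A)"
    by (intro derivative_intros)
  moreover have "R Y - (Y - sym_part Y) = spd_sqrt (sym_part Y)"
    "R' E - (E - sym_part E) = X (sym_part E)" for Y E
    by (simp_all add: R_def R'_def)
  ultimately have "((\<lambda>Y. spd_sqrt (sym_part Y)) has_derivative (\<lambda>E. X (sym_part E)))
      (at A within sym_mats)"
    by (simp only: has_derivative_at_withinI)
  moreover have "A \<in> sym_mats"
    using sym_sq[of S] S SS by (simp add: spd_mats_def)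
  ultimately have "(spd_sqrt has_derivative (\<lambda>E. X (sym_part E))) (at A within sym_mats)"
    by (rule has_derivative_transform_within[OF _ zero_less_one]) (simp only: sym_part_sym)
  then show ?thesis
    unfolding X_def H_def s_def sqrt_diag_def vec_lambda_beta .
qed

section \<open>The Cholesky factor\<close>

definition strict_linear :: "('n \<Rightarrow> 'n \<Rightarrow> bool) \<Rightarrow> bool" where
  "strict_linear r \<longleftrightarrow> transp r \<and> irreflp r \<and> totalp r"

lemma strict_linearD:
  assumes "strict_linear r"
  shows "r i j \<or> r j i \<or> i = j" "r i j \<Longrightarrow> \<not> r j i" "\<not> r i i"
    "r i j \<Longrightarrow> r j k \<Longrightarrow> r i k"
  using assms by (auto simp: strict_linear_def totalp_on_def dest: transpD irreflpD)

lemma strict_linear_less: "strict_linear ((<) :: 'a::linorder \<Rightarrow> 'a \<Rightarrow> bool)"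
  by (auto simp: strict_linear_def irreflp_def totalp_on_def)

lemma strict_linear_wfp:
  fixes r :: "'n::finite \<Rightarrow> 'n \<Rightarrow> bool"
  assumes "strict_linear r"
  shows "wfp r"
  using assms strict_linearD(2)[OF assms] strict_partial_order_wfp_on_finite_set[of UNIV r]
  by (auto simp: strict_linear_def intro!: asympI)

definition lower_pos :: "('n \<Rightarrow> 'n \<Rightarrow> bool) \<Rightarrow> real^'n^'n \<Rightarrow> bool" where
  "lower_pos r L \<longleftrightarrow> (\<forall>i j. r i j \<longrightarrow> L $ i $ j = 0) \<and> (\<forall>i. L $ i $ i > 0)"

text \<open>Forward substitution: once the earlier coordinates of a kernel vector vanish, row i
  reduces to \<open>L $ i $ i * x $ i = 0\<close>.\<close>

lemma lower_pos_invertible: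
  fixes L :: "real^'n::finite^'n"
  assumes r: "strict_linear r" and L: "lower_pos r L"
  shows "invertible L"
proof -
  have "x = 0" if x: "L *v x = 0" for x
  proof -
    have "x $ i = 0" for i
      using strict_linear_wfp[OF r]
    proof (induction i rule: wfp_induct_rule)
      case (less i)
      have "L $ i $ k * x $ k = 0" if "k \<noteq> i" for k
        using that strict_linearD(1)[OF r, of i k] L less by (auto simp: lower_pos_def)
      then have "(\<Sum>k\<in>UNIV - {i}. L $ i $ k * x $ k) = 0"
        by (intro sum.neutral) auto
      then have "(L *v x) $ i = L $ i $ i * x $ i"
        by (simp add: matrix_vector_mult_def sum.remove[of UNIV i])
      then show ?case
        using x L by (metis lower_pos_def less_irrefl mult_eq_0_iff zero_index)
    qed
    then show ?thesis
      by (simp add: vec_eq_iff)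
  qed
  then have "\<exists>B. B ** L = mat 1"
    using matrix_left_invertible_ker by blast
  then show ?thesis
    using invertible_left_inverse by blast
qed

text \<open>Column j of the product involves only columns up to j of the factor, so the columns are
  determined one after another.\<close>

lemma lower_pos_unique:
  fixes L M :: "real^'n::finite^'n"
  assumes r: "strict_linear r" and L: "lower_pos r L" and M: "lower_pos r M"
    and eq: "L ** transpose L = M ** transpose M"
  shows "L = M"
proof -
  have col: "(N ** transpose N) $ i $ j = N $ i $ j * N $ j $ j + (\<Sum>k | r k j. N $ i $ k * N $ j $ k)"
    if "lower_pos r N" for N i j
  proof -
    have "(N ** transpose N) $ i $ j = (\<Sum>k\<in>UNIV. N $ i $ k * N $ j $ k)"
      by (simp add: matrix_matrix_mult_def transpose_def)
    also have "\<dots> = (\<Sum>k\<in>insert j {k. r k j}. N $ i $ k * N $ j $ k)"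
    proof (rule sum.mono_neutral_right)
      show "\<forall>k\<in>UNIV - insert j {k. r k j}. N $ i $ k * N $ j $ k = 0"
        using that strict_linearD(1)[OF r] by (fastforce simp: lower_pos_def)
    qed auto
    also have "\<dots> = N $ i $ j * N $ j $ j + (\<Sum>k | r k j. N $ i $ k * N $ j $ k)"
      using strict_linearD(3)[OF r] by (subst sum.insert) auto
    finally show ?thesis .
  qed
  have "\<forall>i. L $ i $ j = M $ i $ j" for j
    using strict_linear_wfp[OF r]
  proof (induction j rule: wfp_induct_rule)
    case (less j)
    have e: "L $ i $ j * L $ j $ j = M $ i $ j * M $ j $ j" for i
    proof -
      have "(\<Sum>k | r k j. L $ i $ k * L $ j $ k) = (\<Sum>k | r k j. M $ i $ k * M $ j $ k)"
        using less by (intro sum.cong) auto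
      then show ?thesis
        using col[OF L, of i j] col[OF M, of i j] eq by simp
    qed
    have pos: "L $ j $ j > 0" "M $ j $ j > 0"
      using L M by (auto simp: lower_pos_def)
    \<comment> \<open>For i = j the equation \<open>e\<close> compares squares, and positivity
      removes the sign. The rest of the column follows by division.\<close>
    then have "L $ j $ j = M $ j $ j"
      using e[of j] by (metis abs_of_pos real_sqrt_abs2)
    then show ?case
      using e pos by (metis less_irrefl mult_right_cancel)
  qed
  then show ?thesis
    by (simp add: vec_eq_iff)
qed

lemma cholesky_eqI:
  fixes L :: "real^'n::finite^'n"
  assumes r: "strict_linear r" and L: "lower_pos r L" and eq: "L ** transpose L = A"
  shows "cholesky r A = L"
  unfolding cholesky_def
proof (rule the_equality)
  show "(\<forall>i j. r i j \<longrightarrow> L $ i $ j = 0) \<and> (\<forall>i. 0 < L $ i $ i) \<and> L ** transpose L = A"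
    using L eq by (simp add: lower_pos_def)
  show "M = L"
    if "(\<forall>i j. r i j \<longrightarrow> M $ i $ j = 0) \<and> (\<forall>i. 0 < M $ i $ i) \<and> M ** transpose M = A" for M
    using that eq by (intro lower_pos_unique[OF r _ L]) (auto simp: lower_pos_def)
qed

text \<open>Induction over index sets \<open>I\<close>, adding a largest index \<open>b\<close>: off \<open>I\<close> the factor is kept equal
  to the identity, which makes it invertible as a whole. The new row solves \<open>L l = a\<close> for the
  column \<open>a\<close> of \<open>A\<close>, and the Schur complement \<open>A\<^sub>b\<^sub>b - l \<bullet> l\<close> is the value of the quadratic form of
  \<open>A\<close> at \<open>e\<^sub>b - L\<^sup>-\<^sup>T l\<close>, hence positive.\<close>

lemma cholesky_exists:
  fixes A :: "'n::{finite,linorder} sqmat"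
  assumes A: "A \<in> spd_mats"
  obtains L where "lower_pos (<) L" "L ** transpose L = A"
proof -
  note r = strict_linear_less[where 'a = 'n]
  have symA: "A $ i $ j = A $ j $ i" for i j
    using spd_matsD(1)[OF A] by (rule transpose_eqD)
  have "\<exists>L. lower_pos (<) L \<and> (\<forall>i j. i \<notin> I \<or> j \<notin> I \<longrightarrow> L $ i $ j = (if i = j then 1 else 0))
      \<and> (\<forall>i\<in>I. \<forall>j\<in>I. (L ** transpose L) $ i $ j = A $ i $ j)" for I :: "'n set"
    using finite[of I]
  proof (induction I rule: finite_linorder_max_induct)
    case empty
    show ?case
      by (intro exI[of _ "mat 1"]) (auto simp: lower_pos_def mat_def)
  next
    case (insert b I)
    then obtain L :: "'n sqmat" where L: "lower_pos (<) L"
      and id: "\<And>i j. i \<notin> I \<or> j \<notin> I \<Longrightarrow> L $ i $ j = (if i = j then 1 else 0)"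
      and LA: "\<And>i j. i \<in> I \<Longrightarrow> j \<in> I \<Longrightarrow> (L ** transpose L) $ i $ j = A $ i $ j"
      by blast
    have b: "b \<notin> I"
      using insert by auto
    have inv: "L ** matrix_inv L = mat 1"
      using invertible_inv lower_pos_invertible[OF r L] by blast
    define a where "a = (\<chi> i. if i \<in> I then A $ i $ b else 0)"
    define l where "l = matrix_inv L *v a"
    have Ll: "L *v l = a"
      by (simp add: l_def matrix_vector_mul_assoc inv)
    \<comment> \<open>Off \<open>I\<close> the rows of \<open>L\<close> are those of the identity,
      so \<open>l\<close> inherits the zeros of \<open>a\<close>. The columns of \<open>L\<close>
      give the same for \<open>y\<close> below.\<close>
    have l0: "l $ i = 0" if "i \<notin> I" for i
    proof -
      have "(L *v l) $ i = (\<Sum>k\<in>UNIV. (if i = k then 1 else 0) * l $ k)"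
        using id that by (simp add: matrix_vector_mult_def)
      also have "\<dots> = l $ i"
        by (simp add: if_distrib[of "\<lambda>x. x * _"] cong: if_cong)
      finally show ?thesis
        using that by (simp add: Ll a_def)
    qed
    define y where "y = transpose (matrix_inv L) *v l"
    have Ly: "transpose L *v y = l"
      using inv unfolding y_def
      by (metis matrix_transpose_mul matrix_vector_mul_assoc matrix_vector_mul_lid
          matrix_left_right_inverse transpose_mat)
    have y0: "y $ k = 0" if "k \<notin> I" for k
    proof -
      have "(transpose L *v y) $ k = (\<Sum>i\<in>UNIV. (if i = k then 1 else 0) * y $ i)"
        using id that by (simp add: matrix_vector_mult_def transpose_def del: transpose_matrix_vector)
      also have "\<dots> = y $ k"
        by (simp add: if_distrib[of "\<lambda>x. x * _"] cong: if_cong)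
      finally show ?thesis
        using that by (simp add: Ly l0 del: transpose_matrix_vector)
    qed
    define d where "d = A $ b $ b - l \<bullet> l"
    have "d > 0"
    proof -
      let ?x = "axis b 1 - y"
      have "?x $ b \<noteq> 0"
        using y0[OF b] by simp
      then have "?x \<noteq> 0"
        by (metis zero_index)
      then have "0 < ?x \<bullet> (A *v ?x)"
        by (rule spd_matsD(2)[OF A])
      also have "\<dots> = axis b 1 \<bullet> (A *v axis b 1) - 2 * (y \<bullet> (A *v axis b 1)) + y \<bullet> (A *v y)"
      proof -
        have "axis b 1 \<bullet> (A *v y) = y \<bullet> (A *v axis b 1)"
          using inner_matrix_vector[of "axis b 1" A y] spd_matsD(1)[OF A]
          by (simp add: inner_commute del: transpose_matrix_vector)
        then show ?thesis
          by (simp add: inner_diff_left inner_diff_right matrix_vector_mult_diff_distrib)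
      qed
      also have "axis b 1 \<bullet> (A *v axis b 1) = A $ b $ b"
        by (simp add: inner_axis' matrix_vector_mul_component inner_axis)
      \<comment> \<open>\<open>y\<close> is supported in \<open>I\<close>, where \<open>a\<close> is
        column \<open>b\<close> of \<open>A\<close>. For the same reason \<open>A\<close> may be
        replaced by \<open>L ** transpose L\<close> in the form at \<open>y\<close> below.\<close>
      also have "y \<bullet> (A *v axis b 1) = y \<bullet> a"
        unfolding inner_vec_def
        by (rule sum.cong) (auto simp: y0 a_def matrix_vector_mul_component inner_axis)
      also have "y \<bullet> a = l \<bullet> l"
        using inner_matrix_vector[of y L l] by (simp only: Ll Ly)
      also have "y \<bullet> (A *v y) = y \<bullet> ((L ** transpose L) *v y)"
      proof -
        have "y $ i * (A $ i $ k * y $ k) = y $ i * ((L ** transpose L) $ i $ k * y $ k)" for i k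
          using y0 LA by (cases "i \<in> I"; cases "k \<in> I") auto
        then show ?thesis
          unfolding inner_vec_def matrix_vector_mult_def
          by (simp only: sum_distrib_left vec_lambda_beta inner_real_def)
      qed
      also have "\<dots> = l \<bullet> l"
        using inner_matrix_vector[of y L "transpose L *v y"]
        by (simp only: matrix_vector_mul_assoc[symmetric] Ly)
      finally show ?thesis
        by (simp add: d_def)
    qed
    \<comment> \<open>Row \<open>b\<close> becomes \<open>l\<close> with \<open>sqrt d\<close> on
      the diagonal. Since \<open>l\<close> vanishes off \<open>I\<close> and \<open>b\<close>
      exceeds all of \<open>I\<close>, the matrix stays triangular.\<close>
    define M where "M = (\<chi> i j. if i = b then (if j = b then sqrt d else l $ j) else L $ i $ j)"
    have nth: "(N ** transpose N) $ i $ j = (\<Sum>k\<in>UNIV. N $ i $ k * N $ j $ k)" for N :: "'n sqmat" and i j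
      by (simp add: matrix_matrix_mult_def transpose_def)
    have split: "(\<Sum>k\<in>UNIV. f k) = f b + (\<Sum>k\<in>UNIV - {b}. f k)" for f :: "'n \<Rightarrow> real"
      by (simp add: sum.remove[of UNIV b])
    have MM: "(M ** transpose M) $ b $ j = A $ b $ j" if "j \<in> insert b I" for j
    proof (cases "j = b")
      case True
      have "(M ** transpose M) $ b $ b = d + (\<Sum>k\<in>UNIV - {b}. l $ k * l $ k)"
        using \<open>d > 0\<close> by (simp add: nth split M_def)
      also have "(\<Sum>k\<in>UNIV - {b}. l $ k * l $ k) = l \<bullet> l"
        using l0[OF b] by (simp add: inner_vec_def split)
      finally show ?thesis
        using True by (simp add: d_def)
    next
      case False
      have "(M ** transpose M) $ b $ j = (\<Sum>k\<in>UNIV - {b}. l $ k * L $ j $ k)"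
        using False b id[of j b] by (simp add: nth split M_def)
      also have "\<dots> = (L *v l) $ j"
        using l0[OF b] by (simp add: matrix_vector_mult_def split mult.commute)
      finally show ?thesis
        using False that by (simp add: Ll a_def symA)
    qed
    have MMs: "(M ** transpose M) $ i $ j = (M ** transpose M) $ j $ i" for i j
      by (simp add: nth mult.commute)
    show ?case
    proof (intro exI[of _ M] conjI allI impI ballI)
      show "lower_pos (<) M"
        using L \<open>d > 0\<close> insert(2) l0 unfolding lower_pos_def M_def by (auto dest: less_asym)
      show "M $ i $ j = (if i = j then 1 else 0)" if "i \<notin> insert b I \<or> j \<notin> insert b I" for i j
        using that id l0 by (auto simp: M_def)
      show "(M ** transpose M) $ i $ j = A $ i $ j" if "i \<in> insert b I" "j \<in> insert b I" for i j
      proof (cases "i = b \<or> j = b")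
        case True
        then show ?thesis
          using MM that MMs symA by metis
      next
        case False
        then have "(M ** transpose M) $ i $ j = (L ** transpose L) $ i $ j"
          by (simp add: nth M_def)
        then show ?thesis
          using False that LA by simp
      qed
    qed
  qed
  from this[of UNIV] show ?thesis
    using that by (auto simp: vec_eq_iff)
qed

text \<open>The diagonal occurs in both summands, which is why it is halved.\<close>

lemma lower_half_add_transpose:
  assumes r: "strict_linear r" and E: "E \<in> sym_mats"
  shows "lower_half r E + transpose (lower_half r E) = E"
proof -
  have "E $ i $ j = E $ j $ i" for i j
    using E by (intro transpose_eqD) (simp add: sym_mats_def)
  then show ?thesis
    using strict_linearD(1-3)[OF r] by (auto simp: vec_eq_iff lower_half_def transpose_def)
qed

lemma lower_mult:
  fixes L M :: "real^'n::finite^'n"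
  assumes r: "strict_linear r" and L: "\<And>i j. r i j \<Longrightarrow> L $ i $ j = 0"
    and M: "\<And>i j. r i j \<Longrightarrow> M $ i $ j = 0" and "r i j"
  shows "(L ** M) $ i $ j = 0"
proof -
  have "L $ i $ k * M $ k $ j = 0" for k
    using strict_linearD[OF r] L M \<open>r i j\<close> by (metis mult_zero_left mult_zero_right)
  then have "(\<Sum>k\<in>UNIV. L $ i $ k * M $ k $ j) = 0"
    by (rule sum.neutral[OF ballI])
  then show ?thesis
    by (simp add: matrix_matrix_mult_def)
qed

lemma lower_half_lower:
  assumes "strict_linear r" "r i j"
  shows "lower_half r E $ i $ j = 0"
  using assms strict_linearD(2,3)[OF assms(1)] by (auto simp: lower_half_def)

definition upper_part :: "('n \<Rightarrow> 'n \<Rightarrow> bool) \<Rightarrow> real^'n^'n \<Rightarrow> real^'n^'n" where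
  "upper_part r M = (\<chi> i j. if r i j then M $ i $ j else 0)"

lemma linear_upper_part: "linear (upper_part r :: real^'n^'n \<Rightarrow> real^'n^'n)"
  by (auto intro!: linearI simp: vec_eq_iff upper_part_def)

lemma has_derivative_upper_part [derivative_intros]:
  "(f has_derivative f') F \<Longrightarrow> ((\<lambda>x. upper_part r (f x)) has_derivative (\<lambda>x. upper_part r (f' x))) F"
  using bounded_linear.has_derivative[OF linear_upper_part[unfolded linear_conv_bounded_linear]] .

text \<open>The map \<open>M \<mapsto> L L\<^sup>T + (N - N\<^sup>T)\<close>, where \<open>N\<close> is the strictly upper triangular part of \<open>M\<close> and
  \<open>L = M - N\<close>, extends \<open>L \<mapsto> L L\<^sup>T\<close> to all matrices and is injective on the open set of matrices
  with positive diagonal.\<close>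

lemma cholesky_has_derivative:
  fixes L :: "real^'n::finite^'n"
  assumes r: "strict_linear r" and L: "lower_pos r L" and A: "L ** transpose L = A"
  shows "(cholesky r has_derivative
      (\<lambda>E. L ** lower_half r (matrix_inv L ** sym_part E ** transpose (matrix_inv L))))
      (at A within sym_mats)"
proof -
  define X where "X = (\<lambda>E. L ** lower_half r (matrix_inv L ** E ** transpose (matrix_inv L)))"
  define low where "low = (\<lambda>M :: real^'n^'n. M - upper_part r M)"
  \<comment> \<open>\<open>Y - sym_part Y\<close> is the antisymmetric part. For
    \<open>Y = F M\<close> it is N - N^T with N strictly upper triangular, so its strictly upper
    part is N.\<close>
  define up where "up = (\<lambda>Y :: real^'n^'n. upper_part r (Y - sym_part Y))"
  define F where "F = (\<lambda>M. low M ** transpose (low M) + (upper_part r M - transpose (upper_part r M)))"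
  define R where "R = (\<lambda>Y. cholesky r (sym_part Y) + up Y)"
  define F' where "F' = (\<lambda>M. L ** transpose (low M) + low M ** transpose L
      + (upper_part r M - transpose (upper_part r M)))"
  define R' where "R' = (\<lambda>E. X (sym_part E) + up E)"
  note ord = strict_linearD(1-3)[OF r]
  have dF: "(F has_derivative (\<lambda>E. low M ** transpose (low E) + low E ** transpose (low M)
      + (upper_part r E - transpose (upper_part r E)))) (at M)" for M
    unfolding F_def low_def by (auto intro!: derivative_eq_intros)
  have lowL: "low N = N" "upper_part r N = 0" if "\<And>i j. r i j \<Longrightarrow> N $ i $ j = 0" for N
    using that by (auto simp: low_def upper_part_def vec_eq_iff)
  have low_up: "low (N + up Y) = N" "upper_part r (N + up Y) = up Y"
    if "\<And>i j. r i j \<Longrightarrow> N $ i $ j = 0" for N Y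
    using that by (auto simp: low_def up_def upper_part_def vec_eq_iff)
  \<comment> \<open>An antisymmetric matrix is determined by its strictly upper part. This settles
    the antisymmetric half of \<open>F' \<circ> R' = id\<close>.\<close>
  have up_anti: "up Y - transpose (up Y) = Y - sym_part Y" for Y
    using ord by (auto simp: up_def upper_part_def sym_part_def transpose_def vec_eq_iff field_simps)
  have L0: "\<And>i j. r i j \<Longrightarrow> L $ i $ j = 0"
    using L by (simp add: lower_pos_def)
  have anti: "sym_part (B - transpose B) = 0" for B :: "real^'n^'n"
    by (simp add: sym_part_def transpose_diff)
  have sym_sq: "B ** transpose B \<in> sym_mats" for B :: "real^'n^'n"
    by (simp add: sym_mats_def matrix_transpose_mul)
  have "(R has_derivative R') (at (F L))"
  proof (rule has_derivative_inverse_strong[where f = F and x = L])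
    have "{M :: real^'n^'n. \<forall>i. M $ i $ i > 0} = (\<Inter>i. {M. M $ i $ i > 0})"
      by auto
    then show "open {M :: real^'n^'n. \<forall>i. M $ i $ i > 0}"
      by (auto intro!: open_INT open_Collect_less continuous_intros)
    show "L \<in> {M. \<forall>i. M $ i $ i > 0}"
      using L by (simp add: lower_pos_def)
    show "continuous_on {M :: real^'n^'n. \<forall>i. M $ i $ i > 0} F"
      by (intro continuous_at_imp_continuous_on ballI has_derivative_continuous[OF dF])
    show "(F has_derivative F') (at L)"
      using dF[of L] by (simp add: F'_def lowL[OF L0])
    show "R (F M) = M" if "M \<in> {M. \<forall>i. M $ i $ i > 0}" for M
    proof -
      have "lower_pos r (low M)"
        using that ord by (simp add: lower_pos_def low_def upper_part_def)
      moreover have s: "sym_part (F M) = low M ** transpose (low M)"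
        by (simp add: F_def sym_part_add anti sym_part_sym sym_sq)
      ultimately have "cholesky r (sym_part (F M)) = low M"
        by (intro cholesky_eqI[OF r]) simp_all
      moreover have "up (F M) = upper_part r M"
        unfolding up_def s using ord by (auto simp: F_def upper_part_def vec_eq_iff transpose_def)
      ultimately show ?thesis
        by (simp add: R_def low_def)
    qed
    show "F' \<circ> R' = id"
    proof
      fix E :: "real^'n^'n"
      define V where "V = sym_part E"
      define Q where "Q = matrix_inv L ** V ** transpose (matrix_inv L)"
      have X0: "X (sym_part E) $ i $ j = 0" if "r i j" for i j
        unfolding X_def using lower_mult[OF r L0 lower_half_lower[OF r] that] .
      have "low (R' E) = X V" and u: "upper_part r (R' E) = up E"
        unfolding R'_def V_def using low_up[of "X (sym_part E)" E] X0 by auto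
      moreover have "L ** transpose (X V) + X V ** transpose L = V"
      proof -
        have tV: "transpose V = V"
          using sym_part_in_sym[of E] by (simp add: V_def sym_mats_def)
        have inv: "L ** matrix_inv L = mat 1"
          using invertible_inv lower_pos_invertible[OF r L] by blast
        have "Q \<in> sym_mats"
          by (simp add: Q_def sym_mats_def matrix_transpose_mul matrix_mul_assoc tV)
        then have "lower_half r Q + transpose (lower_half r Q) = Q"
          by (rule lower_half_add_transpose[OF r])
        moreover have "L ** transpose (X V) + X V ** transpose L
            = L ** (lower_half r Q + transpose (lower_half r Q)) ** transpose L"
          by (simp add: X_def Q_def matrix_transpose_mul matrix_mul_assoc matrix_add_ldistrib
              matrix_add_rdistrib add.commute)
        ultimately have "L ** transpose (X V) + X V ** transpose L = L ** Q ** transpose L"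
          by simp
        also have "\<dots> = (L ** matrix_inv L) ** V ** transpose (L ** matrix_inv L)"
          by (simp add: Q_def matrix_transpose_mul matrix_mul_assoc)
        finally show ?thesis
          by (simp add: inv)
      qed
      ultimately show "(F' \<circ> R') E = id E"
        by (simp add: F'_def up_anti) (simp add: V_def)
    qed
  qed
  moreover have "F L = A"
    by (simp add: F_def lowL[OF L0] A) (simp add: transpose_def vec_eq_iff)
  ultimately have "(R has_derivative R') (at A)"
    by simp
  \<comment> \<open>As for the square root, the linear part \<open>up\<close> is subtracted and the
    result restricted to symmetric matrices.\<close>
  then have "((\<lambda>Y. R Y - up Y) has_derivative (\<lambda>E. R' E - up E)) (at A)"
    unfolding up_def by (intro derivative_intros)
  moreover have "R Y - up Y = cholesky r (sym_part Y)" "R' E - up E = X (sym_part E)" for Y E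
    by (simp_all add: R_def R'_def)
  ultimately have "((\<lambda>Y. cholesky r (sym_part Y)) has_derivative (\<lambda>E. X (sym_part E)))
      (at A within sym_mats)"
    by (simp only: has_derivative_at_withinI)
  moreover have "A \<in> sym_mats"
    using sym_sq[of L] A by simp
  ultimately have "(cholesky r has_derivative (\<lambda>E. X (sym_part E))) (at A within sym_mats)"
    by (rule has_derivative_transform_within[OF _ zero_less_one]) (simp only: sym_part_sym)
  then show ?thesis
    unfolding X_def .
qed

lemma cholesky_spd:
  fixes A :: "'n::{finite,linorder} sqmat"
  assumes "A \<in> spd_mats"
  shows "lower_pos (<) (cholesky (<) A)" "cholesky (<) A ** transpose (cholesky (<) A) = A"
  using cholesky_exists[OF assms] cholesky_eqI[OF strict_linear_less] by metis+

text \<open>Accounts for the identity factors in the Cholesky formula: conjugation by the inverse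
  factor turns the untouched \<open>\<Sigma>1\<close> or \<open>\<Sigma>2\<close> into the
  identity.\<close>

lemma inv_cholesky_conj:
  fixes L S :: "real^'n::finite^'n"
  assumes "invertible L" "L ** transpose L = S"
  shows "matrix_inv L ** S ** transpose (matrix_inv L) = mat 1"
proof -
  have "matrix_inv L ** S ** transpose (matrix_inv L)
      = (matrix_inv L ** L) ** transpose (matrix_inv L ** L)"
    by (simp add: assms(2)[symmetric] matrix_transpose_mul matrix_mul_assoc)
  then show ?thesis
    using invertible_inv[OF assms(1)] by simp
qed

text \<open>The analogue for the square root: the untouched factor turns into \<Lambda>1 or
  \<Lambda>2.\<close>

lemma eigendecomposition_diag:
  fixes S G D :: "real^'n::finite^'n"
  assumes "eigendecomposition S G D"
  shows "transpose G ** S ** G = D"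
proof -
  have "transpose G ** S ** G = (transpose G ** G) ** D ** (transpose G ** G)"
    using assms by (simp add: eigendecomposition_def matrix_mul_assoc)
  then show ?thesis
    using assms by (simp add: eigendecomposition_def orthogonal_matrix_def)
qed

section \<open>Kronecker products\<close>

lemma kron_mult: "(B \<otimes>\<^sub>K A) ** (D \<otimes>\<^sub>K C) = (B ** D) \<otimes>\<^sub>K (A ** C)"
  by (simp add: vec_eq_iff kron_def matrix_matrix_mult_def sum_product sum.cartesian_product
      UNIV_Times_UNIV[symmetric] case_prod_beta ac_simps del: UNIV_Times_UNIV)

lemma kron_transpose: "transpose (B \<otimes>\<^sub>K A) = transpose B \<otimes>\<^sub>K transpose A"
  by (simp add: vec_eq_iff kron_def transpose_def)

lemma kron_mat: "mat 1 \<otimes>\<^sub>K mat 1 = mat 1"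
  by (auto simp: vec_eq_iff kron_def mat_def prod_eq_iff)

lemma bounded_bilinear_kron:
  "bounded_bilinear ((\<otimes>\<^sub>K) :: real^'b::finite^'b \<Rightarrow> real^'a::finite^'a \<Rightarrow> _)"
  unfolding bilinear_conv_bounded_bilinear[symmetric] bilinear_def
  by (auto intro!: linearI simp: vec_eq_iff kron_def algebra_simps)

lemma kron_in_sym: "B \<in> sym_mats \<Longrightarrow> A \<in> sym_mats \<Longrightarrow> B \<otimes>\<^sub>K A \<in> sym_mats"
  by (simp add: sym_mats_def kron_transpose)

lemma kron_spd_subset_sym: "kron_spd \<subseteq> sym_mats"
  by (auto simp: kron_spd_def spd_mats_def intro: kron_in_sym)

lemma kron_matrix_inv:
  assumes "invertible B" "invertible A"
  shows "matrix_inv (B \<otimes>\<^sub>K A) = matrix_inv B \<otimes>\<^sub>K matrix_inv A"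
  using assms by (intro matrix_inv_eqI) (simp add: kron_mult invertible_inv kron_mat)

lemma eigendecomposition_kron:
  assumes B: "eigendecomposition B G2 D2" and A: "eigendecomposition A G1 D1"
  shows "eigendecomposition (B \<otimes>\<^sub>K A) (G2 \<otimes>\<^sub>K G1) (D2 \<otimes>\<^sub>K D1)"
proof -
  have "(D2 \<otimes>\<^sub>K D1) $ x $ y = 0" if "x \<noteq> y" for x y
    using that A B by (auto simp: eigendecomposition_def kron_def prod_eq_iff)
  then show ?thesis
    using A B
    by (simp add: eigendecomposition_def orthogonal_matrix_def kron_mult kron_transpose kron_mat)
qed

text \<open>Multiplicativity of the square root identifies the stated \<Lambda> with the matrix of
  denominators for the eigenvalues of the Kronecker product.\<close>

lemma sqrt_sum_matrix_kron:
  "sqrt_sum_matrix D2 D1 =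
    (\<chi> x y. sqrt ((D2 \<otimes>\<^sub>K D1) $ x $ x) + sqrt ((D2 \<otimes>\<^sub>K D1) $ y $ y))"
  by (simp add: vec_eq_iff sqrt_sum_matrix_def outer_def sqrt_diag_def kron_def real_sqrt_mult)

text \<open>If a pair precedes another lexicographically, either the outer factor has a zero there,
  or the pairs share a block index and the inner factor has one.\<close>

lemma lower_pos_kron:
  assumes "lower_pos (<) L2" "lower_pos (<) L1"
  shows "lower_pos lex_less (L2 \<otimes>\<^sub>K L1)"
  using assms by (auto simp: lower_pos_def lex_less_def kron_def)

lemma strict_linear_lex_less:
  "strict_linear (lex_less :: 'b::linorder \<times> 'a::linorder \<Rightarrow> 'b \<times> 'a \<Rightarrow> bool)"
  unfolding strict_linear_def
  by (auto simp: lex_less_def totalp_on_def prod_eq_iff intro!: transpI irreflpI)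

section \<open>Differentials on the product manifold\<close>

lemma spd_line:
  assumes S: "S \<in> spd_mats" and U: "U \<in> sym_mats"
  shows "\<forall>\<^sub>F t::real in nhds 0. S + t *\<^sub>R U \<in> spd_mats"
proof -
  let ?P = "{A. \<forall>x. x \<noteq> 0 \<longrightarrow> x \<bullet> (A *v x) > 0}"
  have "((\<lambda>t::real. S + t *\<^sub>R U) \<longlongrightarrow> S + 0 *\<^sub>R U) (nhds 0)"
    by (intro tendsto_intros filterlim_ident)
  moreover have "S + 0 *\<^sub>R U \<in> ?P"
    using S by (simp add: spd_mats_def)
  ultimately have "\<forall>\<^sub>F t::real in nhds 0. S + t *\<^sub>R U \<in> ?P"
    by (rule topological_tendstoD[OF _ open_positive_definite])
  moreover have "S + t *\<^sub>R U \<in> sym_mats" for t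
    using S U by (simp add: spd_mats_def sym_mats_def transpose_add transpose_scalar)
  ultimately show ?thesis
    by (simp add: spd_mats_def)
qed

text \<open>Move both factors along straight lines. Openness of positive definiteness keeps the
  product in \<open>kron_spd\<close> for small times, and the Leibniz rule gives the
  velocity.\<close>

lemma kron_tangent:
  assumes S: "S2 \<in> spd_mats" "S1 \<in> spd_mats" and U: "U2 \<in> sym_mats" "U1 \<in> sym_mats"
  shows "U2 \<otimes>\<^sub>K S1 + S2 \<otimes>\<^sub>K U1 \<in> tangent_space kron_spd (S2 \<otimes>\<^sub>K S1)"
proof -
  define c where "c = (\<lambda>t::real. (S2 + t *\<^sub>R U2) \<otimes>\<^sub>K (S1 + t *\<^sub>R U1))"
  have "\<forall>\<^sub>F t in nhds 0. c t \<in> kron_spd"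
    using spd_line[OF S(1) U(1)] spd_line[OF S(2) U(2)]
    by eventually_elim (auto simp: c_def kron_spd_def)
  then obtain e where "e > 0" "\<And>t. \<bar>t\<bar> < e \<Longrightarrow> c t \<in> kron_spd"
    by (auto simp: eventually_nhds_metric dist_real_def)
  moreover have "(c has_vector_derivative (S2 + 0 *\<^sub>R U2) \<otimes>\<^sub>K U1 + U2 \<otimes>\<^sub>K (S1 + 0 *\<^sub>R U1)) (at 0)"
    unfolding c_def
    by (rule bounded_bilinear.has_vector_derivative[OF bounded_bilinear_kron])
      (auto intro!: derivative_eq_intros)
  ultimately show ?thesis
    unfolding tangent_space_def by (auto simp: c_def add.commute intro!: exI[of _ c] exI[of _ e])
qed

lemma tangent_space_Times:
  assumes "u \<in> tangent_space M x" "v \<in> tangent_space N y"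
  shows "(u, v) \<in> tangent_space (M \<times> N) (x, y)"
proof -
  obtain c d where "c > 0" "\<And>t::real. \<bar>t\<bar> < c \<Longrightarrow> d t \<in> M" "d 0 = x"
      "(d has_vector_derivative u) (at 0)"
    using assms(1) unfolding tangent_space_def by blast
  moreover obtain c' d' where "c' > 0" "\<And>t::real. \<bar>t\<bar> < c' \<Longrightarrow> d' t \<in> N" "d' 0 = y"
      "(d' has_vector_derivative v) (at 0)"
    using assms(2) unfolding tangent_space_def by blast
  ultimately show ?thesis
    unfolding tangent_space_def
    by (auto intro!: exI[of _ "\<lambda>t. (d t, d' t)"] exI[of _ "min c c'"] has_vector_derivative_Pair)
qed

text \<open>The product rule. The map is linear in the second argument, so \<open>N\<close> may be
  any set.\<close>

lemma assemble_has_derivative: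
  assumes h: "(h has_derivative h') (at K within M)"
  shows "(assemble h has_derivative (\<lambda>(U, W). h K ** W ** transpose (h K)
      + h' U ** C ** transpose (h K) + h K ** C ** transpose (h' U))) (at (K, C) within M \<times> N)"
proof -
  have "((\<lambda>p. h (fst p)) has_derivative (\<lambda>p. h' (fst p))) (at (K, C) within M \<times> N)"
  proof (rule has_derivative_in_compose[where f = fst and f' = fst and g = h and g' = h'])
    show "(h has_derivative h') (at (fst (K, C)) within fst ` (M \<times> N))"
      using h by (auto intro: has_derivative_subset)
  qed (auto intro!: derivative_intros)
  then have "((\<lambda>p. h (fst p) ** snd p ** transpose (h (fst p))) has_derivative
      (\<lambda>p. h K ** C ** transpose (h' (fst p))
        + (h K ** snd p + h' (fst p) ** C) ** transpose (h K))) (at (K, C) within M \<times> N)"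
    by (auto intro!: derivative_eq_intros)
  then show ?thesis
    by (simp add: assemble_def case_prod_unfold matrix_add_rdistrib ac_simps)
qed

section \<open>The differential of g and the two formulas for dh\<close>

theorem proposition5p2:
  fixes h :: "('p2::{finite,linorder} \<times> 'p1::{finite,linorder}) sqmat \<Rightarrow> ('p2 \<times> 'p1) sqmat"
    and \<Sigma> K C U W :: "('p2 \<times> 'p1) sqmat"
    and \<Sigma>1 U1 L1 \<Gamma>1 \<Lambda>1 :: "'p1 sqmat"
    and \<Sigma>2 U2 L2 \<Gamma>2 \<Lambda>2 :: "'p2 sqmat"
  assumes "CARD('p1) \<ge> 2" and "CARD('p2) \<ge> 2"
    and "h = spd_sqrt \<or> h = cholesky lex_less"
    and "\<Sigma> \<in> spd_mats"
    and "K = kron_map \<Sigma>"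
    and "\<Sigma>1 \<in> spd_mats" and "\<Sigma>2 \<in> spd_mats" and "K = \<Sigma>2 \<otimes>\<^sub>K \<Sigma>1"
    and "C = core_map h \<Sigma>"
    and "U1 \<in> sym_mats" and "U2 \<in> sym_mats" and "U = U2 \<otimes>\<^sub>K \<Sigma>1 + \<Sigma>2 \<otimes>\<^sub>K U1"
    and "W \<in> tangent_space core_spd C"
    and "L1 = cholesky (<) \<Sigma>1" and "L2 = cholesky (<) \<Sigma>2"
    and "eigendecomposition \<Sigma>1 \<Gamma>1 \<Lambda>1" and "eigendecomposition \<Sigma>2 \<Gamma>2 \<Lambda>2"
  shows "U \<in> tangent_space kron_spd K
    \<and> h differentiable (at K within kron_spd)
    \<and> assemble h differentiable (at (K, C) within kron_spd \<times> core_spd)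
    \<and> differential (assemble h) (kron_spd \<times> core_spd) (K, C) (U, W) =
        h K ** W ** transpose (h K)
        + differential h kron_spd K U ** C ** transpose (h K)
        + h K ** C ** transpose (differential h kron_spd K U)
    \<and> (h = cholesky lex_less \<longrightarrow>
        differential h kron_spd K U =
          (L2 \<otimes>\<^sub>K L1) **
          lower_half lex_less
            (mat 1 \<otimes>\<^sub>K (matrix_inv L1 ** U1 ** transpose (matrix_inv L1))
             + (matrix_inv L2 ** U2 ** transpose (matrix_inv L2)) \<otimes>\<^sub>K mat 1))
    \<and> (h = spd_sqrt \<longrightarrow>
        differential h kron_spd K U =
          (\<Gamma>2 \<otimes>\<^sub>K \<Gamma>1) **
          hadamard (entrywise_inverse (sqrt_sum_matrix \<Lambda>2 \<Lambda>1))
            (\<Lambda>2 \<otimes>\<^sub>K (transpose \<Gamma>1 ** U1 ** \<Gamma>1) + (transpose \<Gamma>2 ** U2 ** \<Gamma>2) \<otimes>\<^sub>K \<Lambda>1) **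
          transpose (\<Gamma>2 \<otimes>\<^sub>K \<Gamma>1))"
proof -
  note spd = \<open>\<Sigma>1 \<in> spd_mats\<close> \<open>\<Sigma>2 \<in> spd_mats\<close> and K = \<open>K = \<Sigma>2 \<otimes>\<^sub>K \<Sigma>1\<close>
  define Xc where "Xc = (\<lambda>E. (L2 \<otimes>\<^sub>K L1) ** lower_half lex_less
    (matrix_inv (L2 \<otimes>\<^sub>K L1) ** sym_part E ** transpose (matrix_inv (L2 \<otimes>\<^sub>K L1))))"
  define Xs where "Xs = (\<lambda>E. (\<Gamma>2 \<otimes>\<^sub>K \<Gamma>1) **
    hadamard (entrywise_inverse (sqrt_sum_matrix \<Lambda>2 \<Lambda>1))
      (transpose (\<Gamma>2 \<otimes>\<^sub>K \<Gamma>1) ** sym_part E ** (\<Gamma>2 \<otimes>\<^sub>K \<Gamma>1)) ** transpose (\<Gamma>2 \<otimes>\<^sub>K \<Gamma>1))"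
  have L1: "lower_pos (<) L1" "L1 ** transpose L1 = \<Sigma>1"
    using cholesky_spd[OF spd(1)] \<open>L1 = cholesky (<) \<Sigma>1\<close> by simp_all
  have L2: "lower_pos (<) L2" "L2 ** transpose L2 = \<Sigma>2"
    using cholesky_spd[OF spd(2)] \<open>L2 = cholesky (<) \<Sigma>2\<close> by simp_all
  have inv: "invertible L1" "invertible L2"
    using lower_pos_invertible[OF strict_linear_less] L1(1) L2(1) by blast+
  have chol: "(cholesky lex_less has_derivative Xc) (at K within sym_mats)"
    unfolding Xc_def K using L1 L2
    by (intro cholesky_has_derivative strict_linear_lex_less lower_pos_kron)
      (simp_all add: kron_mult kron_transpose)
  have eig: "eigendecomposition K (\<Gamma>2 \<otimes>\<^sub>K \<Gamma>1) (\<Lambda>2 \<otimes>\<^sub>K \<Lambda>1)"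
    unfolding K by (rule eigendecomposition_kron; fact)
  have "\<Lambda>2 $ i $ i > 0" "\<Lambda>1 $ a $ a > 0" for i a
    by (rule eigenvalue_pos; fact)+
  then have "(\<Lambda>2 \<otimes>\<^sub>K \<Lambda>1) $ x $ x > 0" for x
    by (simp add: kron_def)
  from spd_sqrt_has_derivative[OF eig this]
  have sqrt: "(spd_sqrt has_derivative Xs) (at K within sym_mats)"
    unfolding Xs_def sqrt_sum_matrix_kron .
  define X where "X = (if h = spd_sqrt then Xs else Xc)"
  have "(h has_derivative X) (at K within sym_mats)"
    using \<open>h = spd_sqrt \<or> h = cholesky lex_less\<close> chol sqrt by (auto simp: X_def)
  then have h: "(h has_derivative X) (at K within kron_spd)"
    using kron_spd_subset_sym by (rule has_derivative_subset)
  have U: "U \<in> tangent_space kron_spd K"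
    unfolding \<open>U = U2 \<otimes>\<^sub>K \<Sigma>1 + \<Sigma>2 \<otimes>\<^sub>K U1\<close> K by (rule kron_tangent; fact)
  have "sym_part U = U"
    using assms(10,11) spd unfolding \<open>U = U2 \<otimes>\<^sub>K \<Sigma>1 + \<Sigma>2 \<otimes>\<^sub>K U1\<close>
    by (simp add: sym_part_add sym_part_sym kron_in_sym spd_mats_def)
  note g = assemble_has_derivative[OF h, of C core_spd]
  \<comment> \<open>The value on the tangent vector \<open>U\<close> is the same for every
    derivative, so each formula can be read off from its own derivative without showing that the two
    choices of \<open>h\<close> differ.\<close>
  have c: "differential h kron_spd K U = X' U" if "(h has_derivative X') (at K within sym_mats)" for X'
    using differential_eqI[OF has_derivative_subset[OF that kron_spd_subset_sym] U] .
  have Xc: "Xc U = (L2 \<otimes>\<^sub>K L1) ** lower_half lex_less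
            (mat 1 \<otimes>\<^sub>K (matrix_inv L1 ** U1 ** transpose (matrix_inv L1))
             + (matrix_inv L2 ** U2 ** transpose (matrix_inv L2)) \<otimes>\<^sub>K mat 1)"
    unfolding Xc_def \<open>sym_part U = U\<close>
    unfolding \<open>U = U2 \<otimes>\<^sub>K \<Sigma>1 + \<Sigma>2 \<otimes>\<^sub>K U1\<close>
    by (simp add: kron_matrix_inv inv kron_transpose matrix_add_ldistrib matrix_add_rdistrib
      kron_mult inv_cholesky_conj[OF inv(1) L1(2)] inv_cholesky_conj[OF inv(2) L2(2)] add.commute)
  have Xs: "Xs U = (\<Gamma>2 \<otimes>\<^sub>K \<Gamma>1) **
          hadamard (entrywise_inverse (sqrt_sum_matrix \<Lambda>2 \<Lambda>1))
            (\<Lambda>2 \<otimes>\<^sub>K (transpose \<Gamma>1 ** U1 ** \<Gamma>1) + (transpose \<Gamma>2 ** U2 ** \<Gamma>2) \<otimes>\<^sub>K \<Lambda>1) **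
          transpose (\<Gamma>2 \<otimes>\<^sub>K \<Gamma>1)"
    unfolding Xs_def \<open>sym_part U = U\<close>
    unfolding \<open>U = U2 \<otimes>\<^sub>K \<Sigma>1 + \<Sigma>2 \<otimes>\<^sub>K U1\<close>
    by (simp add: kron_transpose matrix_add_ldistrib matrix_add_rdistrib kron_mult
      eigendecomposition_diag[OF assms(16)] eigendecomposition_diag[OF assms(17)] add.commute)
  have "differential (assemble h) (kron_spd \<times> core_spd) (K, C) (U, W) =
      h K ** W ** transpose (h K) + X U ** C ** transpose (h K) + h K ** C ** transpose (X U)"
    using differential_eqI[OF g tangent_space_Times[OF U \<open>W \<in> tangent_space core_spd C\<close>]] by simp
  moreover have "differential h kron_spd K U = X U"
    using h U by (rule differential_eqI)
  moreover have "h = cholesky lex_less \<longrightarrow> differential h kron_spd K U = Xc U"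
    using c chol by blast
  moreover have "h = spd_sqrt \<longrightarrow> differential h kron_spd K U = Xs U"
    using c sqrt by blast
  ultimately show ?thesis
    using U h g unfolding differentiable_def Xc[symmetric] Xs[symmetric]
    by (intro conjI exI) (assumption | simp)+
qed

end
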